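(* For every integer $n\ge5$, the flip graph $\mathcal{D}_n$ on ordered pairs of disjoint triangulations of a convex $n$-gon is simple, connected, and $2(n-3)$-regular, and its diameter is at most $4n-16$.
   Context: Label the vertices of a convex $n$-gon by $1,\dots,n$. A triangulation is a maximal set of pairwise noncrossing diagonals; two triangulations are disjoint if they share no diagonal. If $(a,b)$ is a diagonal of a triangulation $T$, deleting it leaves a unique quadrilateral $(a,a',b,b')$; the flip of $T$ at $(a,b)$ replaces $(a,b)$ by $(a',b')$. For an ordered pair $(T_1,T_2)$ of disjoint triangulations and a diagonal $(a,b)\in T_i$ ($i\in\{1,2\}$), the flip at $(a,b)_i$ is: (a) flip $(a,b)$ in $T_i$, obtaining a new diagonal $(a',b')$; (b) if $(a',b')\in T_j$ with $j\ne i$, then also flip $(a',b')$ in $T_j$. The flip graph $\mathcal{D}_n$ is the graph whose vertices are the ordered pairs of disjoint triangulations of the $n$-gon, two pairs being adjacent if one is obtained from the other by a flip. *)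

theory Defs
  imports "Graph_Theory.Graph_Theory"
begin

text \<open>The vertices of the convex \<open>n\<close>-gon are \<open>1, \<dots>, n\<close> in cyclic order, and a segment is the
  two-element set of its endpoints.\<close>

definition sides :: "nat \<Rightarrow> nat set set" where
  "sides n = {{k, k + 1} | k. 1 \<le> k \<and> k < n} \<union> {{1, n}}"

definition diagonals :: "nat \<Rightarrow> nat set set" where
  "diagonals n = {{a, b} | a b. 1 \<le> a \<and> a < b \<and> b \<le> n} - sides n"

text \<open>By convexity, two diagonals meet in an interior point iff their endpoints interleave.\<close>

definition crossing :: "nat set \<Rightarrow> nat set \<Rightarrow> bool" where
  "crossing d e \<longleftrightarrow> (\<exists>w x y z. w < x \<and> x < y \<and> y < z \<and>
     (d = {w, y} \<and> e = {x, z} \<or> d = {x, z} \<and> e = {w, y}))"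

definition noncrossing :: "nat set set \<Rightarrow> bool" where
  "noncrossing T \<longleftrightarrow> (\<forall>d\<in>T. \<forall>e\<in>T. \<not> crossing d e)"

definition triangulation :: "nat \<Rightarrow> nat set set \<Rightarrow> bool" where
  "triangulation n T \<longleftrightarrow> T \<subseteq> diagonals n \<and> noncrossing T \<and>
     (\<forall>S. T \<subseteq> S \<and> S \<subseteq> diagonals n \<and> noncrossing S \<longrightarrow> S = T)"

text \<open>The quadrilateral \<open>(a, a', b, b')\<close> left after deleting \<open>{a, b}\<close> is given by its four sides;
  that its vertices occur in this cyclic order is expressed by its two diagonals crossing.
  The description is only meaningful when \<open>T\<close> is a triangulation containing \<open>d\<close>.\<close>

definition flipped_diagonal :: "nat \<Rightarrow> nat set set \<Rightarrow> nat set \<Rightarrow> nat set" where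
  "flipped_diagonal n T d = (THE e. \<exists>a a' b b'. d = {a, b} \<and> e = {a', b'} \<and> crossing d e \<and>
     {{a, a'}, {a', b}, {b, b'}, {b', a}} \<subseteq> sides n \<union> (T - {d}))"

definition flip :: "nat \<Rightarrow> nat set set \<Rightarrow> nat set \<Rightarrow> nat set set" where
  "flip n T d = insert (flipped_diagonal n T d) (T - {d})"

type_synonym tpair = "nat set set \<times> nat set set"

definition disjoint_pairs :: "nat \<Rightarrow> tpair set" where
  "disjoint_pairs n = {(T1, T2). triangulation n T1 \<and> triangulation n T2 \<and> T1 \<inter> T2 = {}}"

definition component :: "tpair \<Rightarrow> nat \<Rightarrow> nat set set" where
  "component P i = (if i = 1 then fst P else snd P)"

definition flip_if_present :: "nat \<Rightarrow> nat set set \<Rightarrow> nat set \<Rightarrow> nat set set" where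
  "flip_if_present n T e = (if e \<in> T then flip n T e else T)"

definition pair_flip :: "nat \<Rightarrow> tpair \<Rightarrow> nat \<Rightarrow> nat set \<Rightarrow> tpair" where
  "pair_flip n P i d =
     (if i = 1
      then (flip n (fst P) d, flip_if_present n (snd P) (flipped_diagonal n (fst P) d))
      else (flip_if_present n (fst P) (flipped_diagonal n (snd P) d), flip n (snd P) d))"

text \<open>There is one arc \<open>(P, i, d)\<close> for each flip at \<open>d\<close> in component \<open>i\<close> of the pair \<open>P\<close>, so that loops
  and parallel arcs are not excluded by construction. Following \<open>Graph_Theory\<close>, an undirected
  edge is represented by two opposite arcs, and a finite simple undirected graph is a digraph
  satisfying the locale predicate \<^const>\<open>graph\<close>: it is finite and symmetric and has neither loops
  nor parallel arcs.\<close>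

definition flip_graph :: "nat \<Rightarrow> (tpair, tpair \<times> nat \<times> nat set) pre_digraph" where
  "flip_graph n =
     \<lparr> verts = disjoint_pairs n,
       arcs = {(P, i, d). P \<in> disjoint_pairs n \<and> i \<in> {1, 2} \<and> d \<in> component P i},
       tail = (\<lambda>(P, i, d). P),
       head = (\<lambda>(P, i, d). pair_flip n P i d) \<rparr>"

text \<open>For a symmetric digraph the out-degree is the degree of the undirected graph.\<close>

definition regular :: "nat \<Rightarrow> ('a, 'b) pre_digraph \<Rightarrow> bool" where
  "regular k G \<longleftrightarrow> (\<forall>v\<in>verts G. out_degree G v = k)"

text \<open>With unit weights, \<^const>\<open>wf_digraph.\<mu>\<close> is the least number of arcs on a walk from \<open>u\<close>
  to \<open>v\<close>, and is infinite if there is no such walk.\<close>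

definition graph_diameter :: "('a, 'b) pre_digraph \<Rightarrow> ereal" where
  "graph_diameter G = (SUP u\<in>verts G. SUP v\<in>verts G. wf_digraph.\<mu> G (\<lambda>_. 1) u v)"

end

theory Submission
  imports Defs
begin

text \<open>Every edge of a triangulation other than a polygon side has an apex on either side, so each
  diagonal lies in a unique quadrilateral and can be flipped; a flip of a pair is undone by a flip at
  the last new diagonal. Parallel arcs would need a flip that exchanges the two diagonals of a
  quadrilateral shared by both triangulations; its sides, being in both, would be polygon sides.

  For the diameter, choose \<open>v\<close> with two diagonals of the first triangulation of one of the pairs.
  At most \<open>n - 5\<close> flips turn that triangulation into the fan at \<open>v\<close>, and at most \<open>n - 3\<close> do so for
  the other pair. The second triangulations then avoid \<open>v\<close>, hence have a diagonal at a given
  neighbour \<open>w\<close> of \<open>v\<close>, and at most \<open>n - 4\<close> further flips each, none of which disturbs the first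
  fan, turn them into the fan at \<open>w\<close>. Altogether \<open>(n - 5) + (n - 3) + 2 (n - 4) = 4 n - 16\<close>.\<close>

section \<open>Crossing segments\<close>

text \<open>Eliminates the existential: the four points of the definition are the minima and maxima
  of the two pairs.\<close>

lemma crossing_iff:
  "crossing {a, b} {c, d} \<longleftrightarrow>
     min a b < min c d \<and> min c d < max a b \<and> max a b < max c d \<or>
     min c d < min a b \<and> min a b < max c d \<and> max c d < max a b" (is "?L \<longleftrightarrow> ?R")
proof
  assume ?L
  then obtain w x y z where o: "w < x" "x < y" "y < z"
    and "{a, b} = {w, y} \<and> {c, d} = {x, z} \<or> {a, b} = {x, z} \<and> {c, d} = {w, y}"
    unfolding crossing_def by blast
  then show ?R by (auto simp: doubleton_eq_iff min_def max_def)
next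
  have mm: "{a, b} = {min a b, max a b}" "{c, d} = {min c d, max c d}"
    by (auto simp: min_def max_def)
  assume ?R
  then show ?L unfolding crossing_def
    by (metis mm)
qed

lemma crossing_commute: "crossing d e \<longleftrightarrow> crossing e d"
  unfolding crossing_def by blast

lemma crossing_imp_distinct: "crossing {a, b} d \<Longrightarrow> a \<noteq> b"
  unfolding crossing_def by (auto simp: doubleton_eq_iff)

lemma crossing_ordered:
  assumes "a < b" "c < d"
  shows "crossing {a, b} {c, d} \<longleftrightarrow> a < c \<and> c < b \<and> b < d \<or> c < a \<and> a < d \<and> d < b"
  using assms by (simp add: crossing_iff min_absorb1 max_absorb2)

text \<open>A segment leaves a convex quadrilateral only through a side or at a corner. Crossing a
  diagonal puts it inside, so if it crosses no side it must be the other diagonal.\<close>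

lemma crossing_quadrilateral_ordered:
  assumes "x < y" "w < w'" "w' < z" "z < z'"
    and "\<not> crossing {x, y} {w, w'}" "\<not> crossing {x, y} {w', z}"
    and "\<not> crossing {x, y} {z, z'}" "\<not> crossing {x, y} {w, z'}"
  shows "crossing {x, y} {w, z} \<Longrightarrow> x = w' \<and> y = z'"
    and "crossing {x, y} {w', z'} \<Longrightarrow> x = w \<and> y = z"
proof -
  note [simp] = assms(1-4) less_trans[OF assms(2,3)] less_trans[OF assms(3,4)]
    less_trans[OF less_trans[OF assms(2,3)] assms(4)]
  \<comment> \<open>Each fact excludes one interleaving of \<open>{x, y}\<close> with a side of the
    quadrilateral.\<close>
  have s: "x < w \<Longrightarrow> w < y \<Longrightarrow> w' \<le> y" "w < x \<Longrightarrow> x < w' \<Longrightarrow> y \<le> w'"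
    "x < w' \<Longrightarrow> w' < y \<Longrightarrow> z \<le> y" "w' < x \<Longrightarrow> x < z \<Longrightarrow> y \<le> z"
    "x < z \<Longrightarrow> z < y \<Longrightarrow> z' \<le> y"
    "x < w \<Longrightarrow> w < y \<Longrightarrow> z' \<le> y" "w < x \<Longrightarrow> x < z' \<Longrightarrow> y \<le> z'"
    using assms(5-8) by (simp_all add: crossing_ordered linorder_not_less)
  show "x = w' \<and> y = z'" if "crossing {x, y} {w, z}"
  proof -
    consider "x < w" "w < y" "y < z" | "w < x" "x < z" "z < y"
      using \<open>crossing {x, y} {w, z}\<close> by (auto simp: crossing_ordered)
    then show ?thesis
    proof cases
      case 1
      \<comment> \<open>Here \<open>{x, y}\<close> would cross the closing side
        \<open>{w, z'}\<close>.\<close>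
      then show ?thesis using s(6) assms(4) by simp
    next
      case 2
      then have "y = z'" using s(5,7) assms(4) by (simp add: order_antisym)
      moreover have "x = w'" using 2 s(2,4) assms(3) by (meson leD less_trans linorder_neqE)
      ultimately show ?thesis by simp
    qed
  qed
  show "x = w \<and> y = z" if "crossing {x, y} {w', z'}"
  proof -
    consider "x < w'" "w' < y" "y < z'" | "w' < x" "x < z'" "z' < y"
      using \<open>crossing {x, y} {w', z'}\<close> by (auto simp: crossing_ordered)
    then show ?thesis
    proof cases
      case 1
      then have "y = z" using s(3,5) assms(3) by (meson leD less_trans linorder_neqE)
      moreover have "x = w" using 1 s(2,6) assms(2) by (meson leD less_trans linorder_neqE)
      ultimately show ?thesis by simp
    next
      case 2
      then show ?thesis using s(7) assms(2) by simp
    qed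
  qed
qed

text \<open>The smallest corner is \<open>a\<close> or \<open>a'\<close>; accordingly
  \<open>{a, b}\<close> is the first or the second diagonal of the quadrilateral with sorted
  corners.\<close>

lemma crossing_quadrilateral_sorted:
  assumes "x < y" "a < b" "a' < b'"
    and "crossing {a, b} {a', b'}" "crossing {x, y} {a, b}"
    and n: "\<not> crossing {x, y} {a, a'}" "\<not> crossing {x, y} {a', b}"
      "\<not> crossing {x, y} {b, b'}" "\<not> crossing {x, y} {b', a}"
  shows "{x, y} = {a', b'}"
proof -
  have n': "\<not> crossing {x, y} {a', a}" "\<not> crossing {x, y} {b', b}" "\<not> crossing {x, y} {a, b'}"
    using n by (simp_all add: insert_commute)
  consider "a < a'" "a' < b" "b < b'" | "a' < a" "a < b'" "b' < b"
    using assms(4) unfolding crossing_ordered[OF assms(2,3)] by blast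
  then show ?thesis
  proof cases
    case 1
    then show ?thesis
      using crossing_quadrilateral_ordered(1)[OF assms(1) 1 n(1-3) n'(3) assms(5)] by simp
  next
    case 2
    then show ?thesis
      using crossing_quadrilateral_ordered(2)[OF assms(1) 2 n'(1,3,2) n(2) assms(5)] by simp
  qed
qed

text \<open>Source of the uniqueness of flips. Renaming endpoints reduces it to the sorted case;
  \<open>main\<close> accepts either listing of \<open>{x, y}\<close>.\<close>

lemma crossing_quadrilateral:
  assumes ab: "crossing {a, b} {a', b'}" and xy: "crossing {x, y} {a, b}"
    and n: "\<not> crossing {x, y} {a, a'}" "\<not> crossing {x, y} {a', b}"
      "\<not> crossing {x, y} {b, b'}" "\<not> crossing {x, y} {b', a}"
  shows "{x, y} = {a', b'}"
proof -
  have n': "\<not> crossing {x, y} {a', a}" "\<not> crossing {x, y} {b, a'}"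
      "\<not> crossing {x, y} {b', b}" "\<not> crossing {x, y} {a, b'}"
    using n by (simp_all add: insert_commute)
  have c: "crossing {a, b} {b', a'}" "crossing {b, a} {a', b'}" "crossing {b, a} {b', a'}"
      "crossing {x, y} {b, a}" "{b', a'} = {a', b'}"
    using ab xy by (simp_all add: insert_commute)
  have "x \<noteq> y" "a \<noteq> b" "a' \<noteq> b'"
    using xy ab crossing_commute crossing_imp_distinct by blast+
  have main: "{x, y} = {a', b'}" if "{u, v} = {x, y}" "u < v" for u v
  proof -
    consider "a < b" "a' < b'" | "b < a" "a' < b'" | "a < b" "b' < a'" | "b < a" "b' < a'"
      using \<open>a \<noteq> b\<close> \<open>a' \<noteq> b'\<close> by linarith
    then show ?thesis
      using n n' c ab xy crossing_quadrilateral_sorted[OF that(2)] unfolding that(1)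
      by cases metis+
  qed
  show ?thesis using \<open>x \<noteq> y\<close> main[of x y] main[of y x] by (metis insert_commute linorder_neqE)
qed

section \<open>Sides and diagonals of the polygon\<close>

lemma sides_iff:
  assumes "a < b" "2 \<le> n"
  shows "{a, b} \<in> sides n \<longleftrightarrow> 1 \<le> a \<and> b = a + 1 \<and> b \<le> n \<or> a = 1 \<and> b = n"
  using assms by (auto simp: sides_def doubleton_eq_iff)

lemma side_Suc: "1 \<le> k \<Longrightarrow> k < n \<Longrightarrow> {k, k + 1} \<in> sides n"
  and side_last: "{1, n} \<in> sides n"
  unfolding sides_def by blast+

lemma diagonals_iff:
  assumes "a < b"
  shows "{a, b} \<in> diagonals n \<longleftrightarrow> 1 \<le> a \<and> a + 2 \<le> b \<and> b \<le> n \<and> \<not> (a = 1 \<and> b = n)"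
  using assms by (auto simp: sides_def diagonals_def doubleton_eq_iff)

lemma diagonalE:
  assumes "d \<in> diagonals n"
  obtains a b where "d = {a, b}" "1 \<le> a" "a + 2 \<le> b" "b \<le> n" "\<not> (a = 1 \<and> b = n)"
proof -
  obtain a b where "d = {a, b}" "a < b" using assms unfolding diagonals_def by blast
  then show thesis using that assms diagonals_iff[of a b n] by blast
qed

text \<open>No vertex lies strictly between \<open>k\<close> and \<open>k + 1\<close>, and none
  outside the range from \<open>1\<close> to \<open>n\<close>, so endpoints cannot
  interleave.\<close>

lemma sides_not_crossing:
  assumes "s \<in> sides n" "d \<in> diagonals n"
  shows "\<not> crossing s d"
proof -
  obtain a b where ab: "d = {a, b}" "1 \<le> a" "a + 2 \<le> b" "b \<le> n"
    using assms(2) by (rule diagonalE)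
  consider k where "s = {k, k + 1}" | "s = {1, n}" using assms(1) by (auto simp: sides_def)
  then show ?thesis
  proof cases
    case (1 k)
    with ab show ?thesis by (simp add: crossing_ordered)
  next
    case 2
    with ab show ?thesis by (simp add: crossing_ordered)
  qed
qed

text \<open>Two distinct vertices span a side or a diagonal, and sides cross no diagonal.\<close>

lemma crossing_is_diagonal:
  assumes "crossing {p, q} d" "d \<in> diagonals n" "1 \<le> p" "p \<le> n" "1 \<le> q" "q \<le> n"
  shows "{p, q} \<in> diagonals n"
proof -
  have "{p, q} \<notin> sides n" using assms sides_not_crossing by blast
  moreover have "p \<noteq> q" using assms(1) by (rule crossing_imp_distinct)
  moreover have "{x, y} \<in> diagonals n" if "x < y" "1 \<le> x" "y \<le> n" "{x, y} \<notin> sides n" for x y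
    using that unfolding diagonals_def by blast
  ultimately show ?thesis
    using assms(3-6) by (metis insert_commute linorder_neqE_nat)
qed

lemma finite_diagonals: "finite (diagonals n)"
proof -
  have "diagonals n \<subseteq> Pow {..n}" unfolding diagonals_def by auto
  then show ?thesis by (rule finite_subset) simp
qed

text \<open>The first three sides join consecutive labels, so the closing one can only be
  \<open>{1, n}\<close>.\<close>

lemma quadrilateral_not_all_sides:
  assumes "w < x" "x < y" "y < z" "{w, x} \<in> sides n" "{x, y} \<in> sides n"
    "{y, z} \<in> sides n" "{w, z} \<in> sides n" "2 \<le> n"
  shows "n = 4"
proof -
  have "w < z" using assms(1-3) by linarith
  have "z \<le> n" "1 \<le> w" using assms(7,8) \<open>w < z\<close> by (auto simp: sides_iff)
  then have "x = w + 1" "y = x + 1" "z = y + 1"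
    using assms(1-3) sides_iff[OF assms(1,8)] sides_iff[OF assms(2,8)] sides_iff[OF assms(3,8)] assms(4-6)
    by linarith+
  moreover have "w = 1 \<and> z = n"
    using sides_iff[OF \<open>w < z\<close> assms(8)] assms(1-3,7) by linarith
  ultimately show ?thesis by linarith
qed

text \<open>In a square all four segments joining \<open>d\<close> to \<open>e\<close> are sides;
  larger polygons leave one that is not. This later yields a vertex with two diagonals and excludes
  parallel arcs.\<close>

lemma crossing_ex_not_side:
  assumes "crossing d e" "5 \<le> n"
  obtains u v where "u \<in> d" "v \<in> e" "{u, v} \<notin> sides n"
proof -
  obtain w x y z where o: "w < x" "x < y" "y < z"
    and de: "d = {w, y} \<and> e = {x, z} \<or> d = {x, z} \<and> e = {w, y}"
    using assms(1) unfolding crossing_def by blast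
  have "\<not> ({w, x} \<in> sides n \<and> {x, y} \<in> sides n \<and> {y, z} \<in> sides n \<and> {w, z} \<in> sides n)"
    using quadrilateral_not_all_sides[OF o, of n] assms(2) by auto
  then obtain s t where st: "s \<in> {w, y}" "t \<in> {x, z}" "{s, t} \<notin> sides n"
    by (metis insertCI insert_commute)
  from de show thesis
  proof
    assume "d = {w, y} \<and> e = {x, z}"
    then show thesis using that st by blast
  next
    assume "d = {x, z} \<and> e = {w, y}"
    then show thesis using that[of t s] st by (simp add: insert_commute)
  qed
qed

section \<open>Triangles of a triangulation\<close>

lemma triangulation_subset: "triangulation n T \<Longrightarrow> T \<subseteq> diagonals n"
  by (simp add: triangulation_def)

lemma triangulation_finite: "triangulation n T \<Longrightarrow> finite T"
  by (meson finite_diagonals finite_subset triangulation_subset)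

lemma triangulation_not_crossing:
  assumes T: "triangulation n T" and e: "e \<in> sides n \<union> T" and f: "f \<in> T"
  shows "\<not> crossing e f" and "\<not> crossing f e"
proof -
  have "f \<in> diagonals n" using triangulation_subset[OF T] f by blast
  moreover have "\<not> crossing e f" if "e \<in> T"
    using T that f unfolding triangulation_def noncrossing_def by blast
  ultimately show "\<not> crossing e f" using e sides_not_crossing by blast
  then show "\<not> crossing f e" by (simp add: crossing_commute)
qed

lemma not_crossing_self: "e \<in> diagonals n \<Longrightarrow> \<not> crossing e e"
  by (auto simp: crossing_ordered elim!: diagonalE)

lemma triangulation_maximal:
  assumes "triangulation n T" "e \<in> diagonals n" "\<And>f. f \<in> T \<Longrightarrow> \<not> crossing e f"
  shows "e \<in> T"
proof -
  have "noncrossing T" using assms(1) by (simp add: triangulation_def)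
  then have "noncrossing (insert e T)"
    using assms(2,3) not_crossing_self unfolding noncrossing_def by (auto simp: crossing_commute)
  moreover have "insert e T \<subseteq> diagonals n" using assms(1,2) triangulation_subset by blast
  ultimately have "insert e T = T" using assms(1) unfolding triangulation_def by blast
  then show ?thesis by blast
qed

text \<open>Maximality in the form in which it is checked: every further diagonal meets an
  obstruction in \<open>T\<close>.\<close>

lemma triangulationI:
  assumes "T \<subseteq> diagonals n" "noncrossing T"
    and "\<And>e. e \<in> diagonals n \<Longrightarrow> e \<notin> T \<Longrightarrow> \<exists>f\<in>T. crossing e f"
  shows "triangulation n T"
  unfolding triangulation_def
proof (intro conjI allI impI assms(1,2))
  fix S assume S: "T \<subseteq> S \<and> S \<subseteq> diagonals n \<and> noncrossing S"
  have "e \<in> T" if "e \<in> S" for e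
  proof (rule ccontr)
    assume "e \<notin> T"
    then obtain f where "f \<in> T" "crossing e f" using assms(3) S \<open>e \<in> S\<close> by blast
    then show False using S \<open>e \<in> S\<close> unfolding noncrossing_def by blast
  qed
  then show "S = T" using S by blast
qed

lemma edge_range:
  assumes "triangulation n T" "{x, y} \<in> sides n \<union> T" "2 \<le> n"
  shows "1 \<le> x" "x \<le> n" "1 \<le> y" "y \<le> n" "x \<noteq> y"
proof -
  have "1 \<le> x \<and> x \<le> n \<and> 1 \<le> y \<and> y \<le> n \<and> x \<noteq> y"
  proof (cases "{x, y} \<in> sides n")
    case True
    then show ?thesis using assms(3) by (auto simp: sides_def doubleton_eq_iff)
  next
    case False
    then have "{x, y} \<in> diagonals n" using assms triangulation_subset by blast
    then obtain a b where "{x, y} = {a, b}" "1 \<le> a" "a + 2 \<le> b" "b \<le> n" by (rule diagonalE)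
    then show ?thesis by (auto simp: doubleton_eq_iff)
  qed
  then show "1 \<le> x" "x \<le> n" "1 \<le> y" "y \<le> n" "x \<noteq> y" by auto
qed

text \<open>The third vertex of the triangle is the furthest neighbour of \<open>a\<close> below \<open>b\<close>.\<close>

lemma inner_apex:
  assumes T: "triangulation n T" and n: "2 \<le> n" and ab: "{a, b} \<in> sides n \<union> T" "a + 2 \<le> b"
  obtains c where "a < c" "c < b" "{a, c} \<in> sides n \<union> T" "{c, b} \<in> sides n \<union> T"
proof -
  note r = edge_range[OF T ab(1) n]
  define C where "C = {c. a < c \<and> c < b \<and> {a, c} \<in> sides n \<union> T}"
  \<comment> \<open>The polygon side \<open>{a, a + 1}\<close> guarantees a candidate.\<close>
  have "a + 1 \<in> C" using ab(2) r side_Suc[of a n] by (simp add: C_def)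
  moreover have fin: "finite C" by (rule finite_subset[of _ "{..b}"]) (auto simp: C_def)
  ultimately have c: "Max C \<in> C" using Max_in by blast
  define c where "c = Max C"
  have ac: "a < c" "c < b" "{a, c} \<in> sides n \<union> T" using c unfolding C_def c_def by blast+
  have max: "x \<le> c" if "a < x" "x < b" "{a, x} \<in> sides n \<union> T" for x
    using that Max_ge[OF fin, of x] unfolding c_def C_def by blast
  have "{c, b} \<in> sides n \<union> T"
  proof (cases "c + 1 = b")
    case True with r ac side_Suc[of c n] show ?thesis by simp
  next
    case False
    have "{c, b} \<in> T"
    proof (rule triangulation_maximal[OF T])
      show "{c, b} \<in> diagonals n" using False ac(1,2) r by (simp add: diagonals_iff)
      fix f assume f: "f \<in> T"
      with T obtain x y where xy: "f = {x, y}" "x < y"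
        by (metis diagonalE triangulation_subset subsetD less_le_trans less_add_same_cancel1 zero_less_numeral)
      have 1: "\<not> crossing {a, b} {x, y}" "\<not> crossing {a, c} {x, y}"
        using triangulation_not_crossing(1)[OF T _ f] ab(1) ac(3) xy(1) by blast+
      show "\<not> crossing {c, b} f"
      proof
        assume "crossing {c, b} f"
        \<comment> \<open>In the first case \<open>f\<close> also crosses \<open>{a, b}\<close>. In
          the second, avoiding \<open>{a, b}\<close> and \<open>{a, c}\<close> forces
          \<open>x = a\<close>, so \<open>y\<close> is a neighbour of \<open>a\<close> beyond the
          maximal \<open>c\<close>.\<close>
        then consider "c < x" "x < b" "b < y" | "x < c" "c < y" "y < b"
          using xy ac by (auto simp: crossing_ordered)
        then show False
        proof cases
          case 1
          with \<open>\<not> crossing {a, b} {x, y}\<close> xy(2) ac(1,2) show False by (simp add: crossing_ordered)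
        next
          case 2
          then have "a \<le> x" "x \<le> a"
            using 1 xy(2) ac(1,2) by (simp_all add: crossing_ordered linorder_not_less[symmetric])
          with 2 max[of y] f xy(1) ac(1,2) show False by simp
        qed
      qed
    qed
    then show ?thesis by simp
  qed
  with ac show thesis using that by blast
qed

text \<open>The inner apex of the shortest edge that spans \<open>{a, b}\<close> strictly is \<open>a\<close> or \<open>b\<close>, so \<open>{a, b}\<close>
  is a side of its triangle.\<close>

lemma outer_apex:
  assumes T: "triangulation n T" and n: "2 \<le> n" and ab: "{a, b} \<in> sides n \<union> T" "a < b" "\<not> (a = 1 \<and> b = n)"
  obtains c where "c < a \<or> b < c" "{a, c} \<in> sides n \<union> T" "{c, b} \<in> sides n \<union> T"
proof -
  note r = edge_range[OF T ab(1) n]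
  define spans where
    "spans k x y \<longleftrightarrow> {x, y} \<in> sides n \<union> T \<and> x \<le> a \<and> b \<le> y \<and> (x, y) \<noteq> (a, b) \<and> k = y - x" for k x y
  \<comment> \<open>The side \<open>{1, n}\<close> spans every edge and differs from
    \<open>{a, b}\<close> by assumption.\<close>
  have "\<exists>k x y. spans k x y"
    using r ab by (intro exI[of _ "n - 1"] exI[of _ 1] exI[of _ n]) (auto simp: spans_def side_last[simplified])
  then obtain k where k: "\<exists>x y. spans k x y" "\<And>l. l < k \<Longrightarrow> \<not> (\<exists>x y. spans l x y)"
    using exists_least_iff[of "\<lambda>k. \<exists>x y. spans k x y"] by blast
  then obtain x y where xy: "spans k x y" by blast
  then have e: "{x, y} \<in> sides n \<union> T" "x \<le> a" "b \<le> y" "(x, y) \<noteq> (a, b)" "k = y - x"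
    unfolding spans_def by blast+
  from e(2-4) ab(2) have "x + 2 \<le> y" by (cases "x = a") auto
  obtain c where c: "x < c" "c < y" "{x, c} \<in> sides n \<union> T" "{c, y} \<in> sides n \<union> T"
    using inner_apex[OF T n e(1) \<open>x + 2 \<le> y\<close>] by blast
  \<comment> \<open>As \<open>(x, y) \<noteq> (a, b)\<close>, an apex strictly between
    \<open>a\<close> and \<open>b\<close> would make \<open>{x, c}\<close> or \<open>{c, y}\<close>
    cross \<open>{a, b}\<close>.\<close>
  have out: "c \<le> a \<or> b \<le> c"
  proof (rule ccontr)
    assume "\<not> ?thesis"
    then have "a < c" "c < b" by auto
    then have "{a, b} \<notin> sides n" using ab(2,3) n by (simp add: sides_iff)
    with ab(1) have "{a, b} \<in> T" by simp
    then have "\<not> crossing {x, c} {a, b}" "\<not> crossing {c, y} {a, b}"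
      using triangulation_not_crossing(1)[OF T] ab(1) c by blast+
    with \<open>a < c\<close> \<open>c < b\<close> c(1,2) e(2-4) ab(2) show False by (simp add: crossing_ordered)
  qed
  show thesis
  proof (cases "c \<le> a")
    case True
    \<comment> \<open>The edge \<open>{c, y}\<close> still covers \<open>{a, b}\<close> but is
      shorter than the minimum, so it is \<open>{a, b}\<close> itself.\<close>
    moreover have "y - c < k" using c(1,2) e(5) by linarith
    then have "\<not> spans (y - c) c y" using k(2) by blast
    ultimately have "c = a" "y = b" using c(4) e(3) unfolding spans_def by blast+
    with that[of x] c(1,3) e(1) show thesis by (simp add: insert_commute)
  next
    case False
    moreover have "c - x < k" using c(1,2) e(5) by linarith
    then have "\<not> spans (c - x) x c" using k(2) by blast
    ultimately have "x = a" "c = b" using c(3) e(2) out unfolding spans_def by blast+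
    with that[of y] c(2,4) e(1) show thesis by (simp add: insert_commute)
  qed
qed

section \<open>Flips\<close>

text \<open>The relation inside the definite description of \<open>flipped_diagonal\<close>,
  separated so that existence and uniqueness can be proved before the description is
  evaluated.\<close>

definition flips_to :: "nat \<Rightarrow> nat set set \<Rightarrow> nat set \<Rightarrow> nat set \<Rightarrow> bool" where
  "flips_to n T d e \<longleftrightarrow> (\<exists>a a' b b'. d = {a, b} \<and> e = {a', b'} \<and> crossing d e \<and>
     {{a, a'}, {a', b}, {b, b'}, {b', a}} \<subseteq> sides n \<union> (T - {d}))"

lemma flips_toI:
  assumes "d = {a, b}" "e = {a', b'}" "crossing d e" "{a, a'} \<in> sides n \<union> (T - {d})"
    "{a', b} \<in> sides n \<union> (T - {d})" "{b, b'} \<in> sides n \<union> (T - {d})" "{b', a} \<in> sides n \<union> (T - {d})"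
  shows "flips_to n T d e"
proof -
  have "{{a, a'}, {a', b}, {b, b'}, {b', a}} \<subseteq> sides n \<union> (T - {d})"
    using assms(4-) by (simp only: insert_subset empty_subsetI simp_thms)
  with assms(1-3) show ?thesis unfolding flips_to_def by (intro exI conjI)
qed

lemma flips_toE:
  assumes "flips_to n T d e"
  obtains a a' b b' where "d = {a, b}" "e = {a', b'}" "crossing d e" "{a, a'} \<in> sides n \<union> (T - {d})"
    "{a', b} \<in> sides n \<union> (T - {d})" "{b, b'} \<in> sides n \<union> (T - {d})" "{b', a} \<in> sides n \<union> (T - {d})"
proof -
  from assms obtain a a' b b' where q: "d = {a, b}" "e = {a', b'}" "crossing d e"
    "{{a, a'}, {a', b}, {b, b'}, {b', a}} \<subseteq> sides n \<union> (T - {d})"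
    unfolding flips_to_def by (elim exE conjE)
  from q(4) show thesis unfolding insert_subset by (intro that[OF q(1-3)]) (elim conjE, assumption)+
qed

text \<open>The same four sides serve for the reverse exchange, since removing the new diagonal
  \<open>e\<close> leaves \<open>T - {d}\<close> again.\<close>

lemma flips_to_commute:
  assumes "flips_to n T d e" "e \<notin> T"
  shows "flips_to n (insert e (T - {d})) e d"
proof -
  obtain a a' b b' where q: "d = {a, b}" "e = {a', b'}" "crossing d e"
    "{a, a'} \<in> sides n \<union> (T - {d})" "{a', b} \<in> sides n \<union> (T - {d})"
    "{b, b'} \<in> sides n \<union> (T - {d})" "{b', a} \<in> sides n \<union> (T - {d})"
    using assms(1) by (rule flips_toE)
  have "insert e (T - {d}) - {e} = T - {d}" using assms(2) by blast
  moreover have "d = {b, a}" "crossing e d" using q(1,3) by (auto simp: crossing_commute)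
  ultimately show ?thesis using flips_toI[OF q(2) \<open>d = {b, a}\<close>, of n "insert e (T - {d})"] q(4-)
    by (simp only: insert_commute)
qed

lemma flips_to_edge:
  assumes "flips_to n T d e" "u \<in> d" "v \<in> e"
  shows "{u, v} \<in> sides n \<union> (T - {d})"
proof -
  obtain a a' b b' where q: "d = {a, b}" "e = {a', b'}"
    "{a, a'} \<in> sides n \<union> (T - {d})" "{a', b} \<in> sides n \<union> (T - {d})"
    "{b, b'} \<in> sides n \<union> (T - {d})" "{b', a} \<in> sides n \<union> (T - {d})"
    using assms(1) by (rule flips_toE)
  have "u = a \<or> u = b" "v = a' \<or> v = b'" using assms(2,3) q(1,2) by auto
  then show ?thesis using q(3-)
    by (elim disjE) (simp_all only: insert_commute[of b a'] insert_commute[of a b'])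
qed

text \<open>The triangles on the two sides of \<open>{a, b}\<close> glue to the quadrilateral; their
  apices are separated by \<open>{a, b}\<close>, which gives the crossing.\<close>

lemma flips_to_apices:
  assumes "d = {a, b}" "a < p" "p < b" "q < a \<or> b < q" "{a, p} \<in> sides n \<union> T"
    "{p, b} \<in> sides n \<union> T" "{a, q} \<in> sides n \<union> T" "{q, b} \<in> sides n \<union> T"
  shows "flips_to n T d {p, q}"
proof -
  have "{a, p} \<noteq> d" "{p, b} \<noteq> d" "{b, q} \<noteq> d" "{q, a} \<noteq> d"
    using assms(2-4) unfolding assms(1) doubleton_eq_iff by auto
  then have m: "{a, p} \<in> sides n \<union> (T - {d})" "{p, b} \<in> sides n \<union> (T - {d})"
    "{b, q} \<in> sides n \<union> (T - {d})" "{q, a} \<in> sides n \<union> (T - {d})"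
    using assms(5-8) by (simp_all add: insert_commute[of q a] insert_commute[of b q])
  have "crossing d {p, q}"
  proof (cases "q < a")
    case True
    then have "crossing {a, b} {q, p}" using assms(2,3) by (simp add: crossing_ordered)
    then show ?thesis using assms(1) by (simp add: insert_commute)
  next
    case False
    then show ?thesis using assms(1-4) by (simp add: crossing_ordered)
  qed
  then show ?thesis using flips_toI[OF assms(1) refl _ m] by blast
qed

lemma ex_flips_to:
  assumes T: "triangulation n T" and d: "d \<in> T"
  shows "\<exists>e. flips_to n T d e"
proof -
  have "d \<in> diagonals n" using assms triangulation_subset by blast
  then obtain a b where ab: "d = {a, b}" "1 \<le> a" "a + 2 \<le> b" "b \<le> n" "\<not> (a = 1 \<and> b = n)"
    by (rule diagonalE)
  then have e: "{a, b} \<in> sides n \<union> T" "a < b" "2 \<le> n" using d by auto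
  obtain p where p: "a < p" "p < b" "{a, p} \<in> sides n \<union> T" "{p, b} \<in> sides n \<union> T"
    using inner_apex[OF T e(3,1) ab(3)] by blast
  obtain q where q: "q < a \<or> b < q" "{a, q} \<in> sides n \<union> T" "{q, b} \<in> sides n \<union> T"
    using outer_apex[OF T e(3,1,2) ab(5)] by blast
  show ?thesis using flips_to_apices[OF ab(1) p(1,2) q(1) p(3,4) q(2,3)] by blast
qed

context
  fixes n T d e
  assumes T: "triangulation n T" and d: "d \<in> T" and flips: "flips_to n T d e"
begin

lemma flips_to_crossing: "crossing d e"
  using flips by (rule flips_toE)

lemma flips_to_diagonal: "e \<in> diagonals n"
proof -
  obtain a a' b b' where q: "e = {a', b'}"
    "{a, a'} \<in> sides n \<union> T" "{b', a} \<in> sides n \<union> T"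
    using flips by (rule flips_toE) blast
  have dd: "d \<in> diagonals n" using T d triangulation_subset by blast
  then have "2 \<le> n" by (auto elim!: diagonalE)
  then have "1 \<le> a'" "a' \<le> n" "1 \<le> b'" "b' \<le> n"
    using edge_range[OF T q(2)] edge_range[OF T q(3)] by auto
  then show ?thesis
    using crossing_is_diagonal[of a' b' d n] flips_to_crossing dd q(1) crossing_commute by blast
qed

lemma flips_to_notin: "e \<notin> T"
  using triangulation_not_crossing(1)[OF T, of d e] d flips_to_crossing by blast

text \<open>A member of \<open>T\<close> crosses none of the four sides of the quadrilateral, so one
  that crosses the diagonal \<open>e\<close> must be the other diagonal.\<close>

lemma crossing_flips_to_imp_eq:
  assumes f: "f \<in> T" "crossing f e"
  shows "f = d"
proof -
  obtain a a' b b' where q: "d = {a, b}" "e = {a', b'}" "crossing d e"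
    "{a, a'} \<in> sides n \<union> T" "{a', b} \<in> sides n \<union> T" "{b, b'} \<in> sides n \<union> T" "{b', a} \<in> sides n \<union> T"
    using flips by (rule flips_toE) blast
  have "f \<in> diagonals n" using T f triangulation_subset by blast
  then obtain x y where xy: "f = {x, y}" by (rule diagonalE)
  have "{x, y} = {b, a}"
  proof (rule crossing_quadrilateral)
    show "crossing {a', b'} {b, a}" using q(1-3) by (simp add: crossing_commute insert_commute)
    show "crossing {x, y} {a', b'}" using f(2) q(2) xy by simp
    show "\<not> crossing {x, y} {a', b}" "\<not> crossing {x, y} {b, b'}"
      "\<not> crossing {x, y} {b', a}" "\<not> crossing {x, y} {a, a'}"
      using triangulation_not_crossing(2)[OF T _ f(1)] q xy by blast+
  qed
  then show ?thesis using xy q(1) by (simp add: insert_commute)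
qed

text \<open>Characterises \<open>e\<close> without mentioning the quadrilateral: it is the only
  diagonal that crosses \<open>d\<close> and is compatible with the rest of \<open>T\<close>. Both
  uniqueness and maximality after a flip rest on this.\<close>

lemma flips_to_eqI:
  assumes f: "f \<in> diagonals n" "crossing f d" "\<And>g. g \<in> T \<Longrightarrow> g \<noteq> d \<Longrightarrow> \<not> crossing f g"
  shows "f = e"
proof -
  obtain a a' b b' where q: "d = {a, b}" "e = {a', b'}" "crossing d e"
    "{a, a'} \<in> sides n \<union> (T - {d})" "{a', b} \<in> sides n \<union> (T - {d})"
    "{b, b'} \<in> sides n \<union> (T - {d})" "{b', a} \<in> sides n \<union> (T - {d})"
    using flips by (rule flips_toE)
  obtain x y where xy: "f = {x, y}" using f(1) by (rule diagonalE)
  have n: "\<not> crossing f g" if "g \<in> sides n \<union> (T - {d})" for g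
  proof (cases "g \<in> sides n")
    case True
    then show ?thesis using f(1) sides_not_crossing[of g n f] crossing_commute[of g f] by blast
  next
    case False
    then show ?thesis using that f(3) by blast
  qed
  have "{x, y} = {a', b'}"
  proof (rule crossing_quadrilateral)
    show "crossing {a, b} {a', b'}" using q(1-3) by simp
    show "crossing {x, y} {a, b}" using f(2) q(1) xy by simp
    show "\<not> crossing {x, y} {a, a'}" "\<not> crossing {x, y} {a', b}"
      "\<not> crossing {x, y} {b, b'}" "\<not> crossing {x, y} {b', a}"
      using n[OF q(4)] n[OF q(5)] n[OF q(6)] n[OF q(7)] xy by simp_all
  qed
  then show ?thesis using xy q(2) by simp
qed

lemma flips_to_triangulation: "triangulation n (insert e (T - {d}))"
proof (rule triangulationI)
  show "insert e (T - {d}) \<subseteq> diagonals n"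
    using triangulation_subset[OF T] flips_to_diagonal by blast
  have TT: "\<not> crossing f g" if "f \<in> T" "g \<in> T" for f g
    using triangulation_not_crossing(1)[OF T _ \<open>g \<in> T\<close>] that by blast
  have Te: "\<not> crossing f e" "\<not> crossing e f" if "f \<in> T - {d}" for f
    using that crossing_flips_to_imp_eq[of f] crossing_commute[of e f] by blast+
  show "noncrossing (insert e (T - {d}))"
    unfolding noncrossing_def using TT Te not_crossing_self[OF flips_to_diagonal] by blast
  fix g assume g: "g \<in> diagonals n" "g \<notin> insert e (T - {d})"
  show "\<exists>f\<in>insert e (T - {d}). crossing g f"
  \<comment> \<open>A compatible \<open>g\<close> that crosses \<open>d\<close> would be
    \<open>e\<close>; one that does not lies in \<open>T\<close> by maximality, hence equals
    \<open>d\<close>, which crosses \<open>e\<close>.\<close>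
  proof (rule ccontr)
    assume not: "\<not> ?thesis"
    then have nT: "\<not> crossing g f" if "f \<in> T" "f \<noteq> d" for f using that by blast
    have ng: "\<not> crossing g e" using not by blast
    have "\<not> crossing g d" using flips_to_eqI[OF g(1) _ nT] g(2) by blast
    then have "g \<in> T" using triangulation_maximal[OF T g(1)] nT by blast
    then have "g = d" using g(2) by blast
    then show False using ng flips_to_crossing by blast
  qed
qed

end

text \<open>Any two candidates satisfy the criterion \<open>flips_to_eqI\<close>, so the definite
  description is well defined.\<close>

lemma flipped_diagonal_eq:
  assumes T: "triangulation n T" and d: "d \<in> T" and e: "flips_to n T d e"
  shows "flipped_diagonal n T d = e"
proof -
  have "e' = e" if e': "flips_to n T d e'" for e'
  proof (rule flips_to_eqI[OF T d e])
    show "e' \<in> diagonals n" using flips_to_diagonal[OF T d e'] .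
    show "crossing e' d" using flips_to_crossing[OF T d e'] by (simp add: crossing_commute)
    show "\<not> crossing e' g" if "g \<in> T" "g \<noteq> d" for g
      using crossing_flips_to_imp_eq[OF T d e', of g] that by (auto simp: crossing_commute)
  qed
  with e show ?thesis
    unfolding flipped_diagonal_def flips_to_def[symmetric] by (rule the_equality)
qed

lemma flip_properties:
  assumes T: "triangulation n T" and d: "d \<in> T"
  defines "e \<equiv> flipped_diagonal n T d"
  shows flips_to_flipped_diagonal: "flips_to n T d e"
    and flipped_diagonal_notin: "e \<notin> T"
    and flipped_diagonal_in_diagonals: "e \<in> diagonals n"
    and crossing_flipped_diagonal: "crossing d e"
    and flip_eq: "flip n T d = insert e (T - {d})"
    and triangulation_flip: "triangulation n (flip n T d)"
    and flipped_diagonal_flip: "flipped_diagonal n (flip n T d) e = d"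
    and flip_flip: "flip n (flip n T d) e = T"
    and card_flip: "card (flip n T d) = card T"
proof -
  show f: "flips_to n T d e" using ex_flips_to[OF T d] flipped_diagonal_eq[OF T d] e_def by blast
  note facts = flips_to_notin[OF T d f] flips_to_diagonal[OF T d f] flips_to_crossing[OF T d f]
  then show "e \<notin> T" "e \<in> diagonals n" "crossing d e" by blast+
  show fl: "flip n T d = insert e (T - {d})" by (simp add: flip_def e_def)
  then show T': "triangulation n (flip n T d)" using flips_to_triangulation[OF T d f] by simp
  have "e \<in> flip n T d" using fl by blast
  then show fd: "flipped_diagonal n (flip n T d) e = d"
    using flipped_diagonal_eq[OF T'] flips_to_commute[OF f facts(1)] fl by simp
  have "flip n (flip n T d) e = insert d (flip n T d - {e})"
    by (subst flip_def) (simp add: fd)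
  then show "flip n (flip n T d) e = T" using fl facts(1) d by auto
  show "card (flip n T d) = card T"
    using fl facts(1) card_Suc_Diff1[OF triangulation_finite[OF T] d] triangulation_finite[OF T]
    by simp
qed

section \<open>Flipping towards a fan\<close>

definition fan :: "nat \<Rightarrow> nat \<Rightarrow> nat set set" where
  "fan n v = {d \<in> diagonals n. v \<in> d}"

text \<open>Counts the flips still to be made on the way to the fan at \<open>v\<close>.\<close>

definition defect :: "nat \<Rightarrow> nat set set \<Rightarrow> nat" where
  "defect v T = card {d \<in> T. v \<notin> d}"

lemma crossing_disjoint: "crossing d e \<Longrightarrow> d \<inter> e = {}"
  unfolding crossing_def by auto

text \<open>Diagonals at \<open>v\<close> share an endpoint and so do not cross; a diagonal avoiding
  \<open>v\<close> separates it from some vertex \<open>z\<close> and is crossed by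
  \<open>{v, z}\<close>.\<close>

lemma triangulation_fan:
  assumes v: "1 \<le> v" "v \<le> n"
  shows "triangulation n (fan n v)"
proof (rule triangulationI)
  show "fan n v \<subseteq> diagonals n" by (auto simp: fan_def)
  show "noncrossing (fan n v)"
    unfolding noncrossing_def fan_def using crossing_disjoint by blast
  fix e assume e: "e \<in> diagonals n" "e \<notin> fan n v"
  then have "v \<notin> e" by (simp add: fan_def)
  obtain x y where xy: "e = {x, y}" "1 \<le> x" "x + 2 \<le> y" "y \<le> n" "\<not> (x = 1 \<and> y = n)"
    using e(1) by (rule diagonalE)
  have "\<exists>z. 1 \<le> z \<and> z \<le> n \<and> crossing {v, z} {x, y}"
  proof -
    \<comment> \<open>The witness \<open>z\<close> must lie on the other side of
      \<open>{x, y}\<close>: \<open>1\<close> or \<open>n\<close> if \<open>v\<close> is inside, and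
      \<open>x + 1\<close> if \<open>v\<close> is outside.\<close>
    consider "x < v" "v < y" "1 < x" | "x < v" "v < y" "y < n" | "v < x" | "y < v"
      using \<open>v \<notin> e\<close> xy by fastforce
    then show ?thesis
    proof cases
      case 1
      then have "crossing {1, v} {x, y}" by (simp add: crossing_ordered)
      then show ?thesis using xy by (intro exI[of _ 1]) (simp add: insert_commute)
    next
      case 2
      then show ?thesis using xy by (intro exI[of _ n]) (simp add: crossing_ordered)
    next
      case 3
      then show ?thesis using xy by (intro exI[of _ "x + 1"]) (simp add: crossing_ordered)
    next
      case 4
      then have "crossing {x + 1, v} {x, y}" using xy by (simp add: crossing_ordered)
      then show ?thesis using xy by (intro exI[of _ "x + 1"]) (simp add: insert_commute)
    qed
  qed
  then obtain z where z: "1 \<le> z" "z \<le> n" "crossing {v, z} e" using xy(1) by blast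
  then have "{v, z} \<in> fan n v" using crossing_is_diagonal[OF z(3) e(1) v] by (simp add: fan_def)
  then show "\<exists>f\<in>fan n v. crossing e f" using z(3) crossing_commute by blast
qed

lemma triangulation_eq_fan:
  assumes "triangulation n T" "1 \<le> v" "v \<le> n" "\<And>d. d \<in> T \<Longrightarrow> v \<in> d"
  shows "T = fan n v"
proof -
  have "T \<subseteq> fan n v" using assms(4) triangulation_subset[OF assms(1)] by (auto simp: fan_def)
  moreover have "fan n v \<subseteq> diagonals n" "noncrossing (fan n v)"
    using triangulation_fan[OF assms(2,3)] by (simp_all add: triangulation_def)
  ultimately show ?thesis using assms(1) unfolding triangulation_def by blast
qed

text \<open>Unless \<open>v\<close> is the apex over \<open>{x, y}\<close> on its own side, it lies strictly behind another side
  of that triangle, which cuts off fewer vertices.\<close>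

lemma ex_flip_towards_vertex_aux:
  assumes T: "triangulation n T" and v: "1 \<le> v" "v \<le> n"
  shows "{x, y} \<in> T \<Longrightarrow> x < y \<Longrightarrow> v \<noteq> x \<Longrightarrow> v \<noteq> y \<Longrightarrow>
    \<exists>d\<in>T. v \<notin> d \<and> v \<in> flipped_diagonal n T d"
\<comment> \<open>The measure is the length of the boundary path from \<open>x\<close> to
  \<open>y\<close> that contains \<open>v\<close>.\<close>
proof (induction "if x < v \<and> v < y then y - x else n - (y - x)" arbitrary: x y rule: less_induct)
  case less
  define m where "m x y = (if x < v \<and> v < y then y - x else n - (y - x))" for x y
  have IH: ?case if "m a b < m x y" "{a, b} \<in> sides n \<union> T" "{a, b} \<notin> sides n" "a < b" "v \<noteq> a" "v \<noteq> b" for a b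
    using less.hyps[of a b] that unfolding m_def by blast
  have "{x, y} \<in> diagonals n" using triangulation_subset[OF T] less.prems(1) by blast
  then have xy: "1 \<le> x" "x + 2 \<le> y" "y \<le> n" "\<not> (x = 1 \<and> y = n)"
    using less.prems(2) by (simp_all add: diagonals_iff)
  have n: "2 \<le> n" using xy by linarith
  have E: "{x, y} \<in> sides n \<union> T" using less.prems(1) by blast
  obtain p where p: "x < p" "p < y" "{x, p} \<in> sides n \<union> T" "{p, y} \<in> sides n \<union> T"
    using inner_apex[OF T n E xy(2)] by blast
  obtain q where q: "q < x \<or> y < q" "{x, q} \<in> sides n \<union> T" "{q, y} \<in> sides n \<union> T"
    using outer_apex[OF T n E less.prems(2) xy(4)] by blast
  have qn: "1 \<le> q" "q \<le> n" using edge_range[OF T q(2) n] by auto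
  have "flips_to n T {x, y} {p, q}" using flips_to_apices[OF refl p(1,2) q(1) p(3,4) q(2,3)] .
  then have fd: "flipped_diagonal n T {x, y} = {p, q}"
    using flipped_diagonal_eq[OF T less.prems(1)] by blast
  show ?case
  proof (cases "v = p \<or> v = q")
    case True
    then show ?thesis using fd less.prems by (intro bexI[of _ "{x, y}"]) auto
  next
    case False
    have qx: "{q, x} \<in> sides n \<union> T" and yq: "{y, q} \<in> sides n \<union> T"
      using q(2,3) by (simp_all only: insert_commute)
    \<comment> \<open>The cases say behind which side of the triangle with apex \<open>p\<close> or
      \<open>q\<close> the vertex \<open>v\<close> lies. Having \<open>v\<close> strictly behind it,
      that edge is no polygon side, so it belongs to \<open>T\<close> and the induction
      applies.\<close>
    consider "x < v" "v < p" | "p < v" "v < y"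
      | "q < x" "q < v" "v < x" | "q < x" "v < q \<or> y < v"
      | "y < q" "y < v" "v < q" | "y < q" "v < x \<or> q < v"
      using False less.prems q(1) by linarith
    then show ?thesis
    proof cases
      case 1
      show ?thesis using 1 p xy n by (intro IH[of x p]) (simp_all add: m_def sides_iff)
    next
      case 2
      show ?thesis using 2 p xy n by (intro IH[of p y]) (simp_all add: m_def sides_iff)
    next
      case 3
      show ?thesis using 3 qx xy qn n by (intro IH[of q x]) (simp_all add: m_def sides_iff)
    next
      case 4
      show ?thesis using 4 q(3) xy qn n v less.prems(2) False
        by (intro IH[of q y]) (auto simp add: m_def sides_iff)
    next
      case 5
      show ?thesis using 5 yq xy qn n by (intro IH[of y q]) (simp_all add: m_def sides_iff)
    next
      case 6
      show ?thesis using 6 q(2) xy qn n v less.prems(2) False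
        by (intro IH[of x q]) (auto simp add: m_def sides_iff)
    qed
  qed
qed

text \<open>The flip trades a diagonal missing \<open>v\<close> for one through \<open>v\<close>, so
  the defect drops by exactly one.\<close>

lemma ex_flip_towards_vertex:
  assumes T: "triangulation n T" and v: "1 \<le> v" "v \<le> n" and k: "defect v T = Suc k"
  obtains d where "d \<in> T" "v \<notin> d" "v \<in> flipped_diagonal n T d" "defect v (flip n T d) = k"
proof -
  have "{d \<in> T. v \<notin> d} \<noteq> {}" using k unfolding defect_def by fastforce
  then obtain f where f: "f \<in> T" "v \<notin> f" by blast
  then have "f \<in> diagonals n" using triangulation_subset[OF T] by blast
  then obtain x y where "f = {x, y}" "x + 2 \<le> y" by (rule diagonalE)
  then have "\<exists>d\<in>T. v \<notin> d \<and> v \<in> flipped_diagonal n T d"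
    using ex_flip_towards_vertex_aux[OF T v, of x y] f by simp
  then obtain d where d: "d \<in> T" "v \<notin> d" "v \<in> flipped_diagonal n T d" by blast
  have "{f \<in> flip n T d. v \<notin> f} = {f \<in> T. v \<notin> f} - {d}"
    using d unfolding flip_eq[OF T d(1)] by blast
  then have "defect v (flip n T d) = k"
    using k d triangulation_finite[OF T] unfolding defect_def by simp
  with d that show thesis by blast
qed

lemma defect_eq_0D:
  assumes "triangulation n T" "1 \<le> v" "v \<le> n" "defect v T = 0"
  shows "T = fan n v"
  using assms triangulation_finite[OF assms(1)]
  by (intro triangulation_eq_fan) (auto simp: defect_def)

section \<open>Counting the diagonals of a triangulation\<close>

lemma card_fan_1:
  assumes "3 \<le> n"
  shows "card (fan n 1) = n - 3"
proof -
  \<comment> \<open>The vertices \<open>2\<close> and \<open>n\<close> are the neighbours of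
    \<open>1\<close>, which leaves \<open>{3..<n}\<close> for the other endpoint.\<close>
  have "fan n 1 = (\<lambda>z. {1, z}) ` {3..<n}"
  proof (intro set_eqI iffI)
    fix d assume "d \<in> fan n 1"
    then have "d \<in> diagonals n" "1 \<in> d" by (auto simp: fan_def)
    obtain x y where xy: "d = {x, y}" "1 \<le> x" "x + 2 \<le> y" "y \<le> n" "\<not> (x = 1 \<and> y = n)"
      using \<open>d \<in> diagonals n\<close> by (rule diagonalE)
    then have "x = 1" using \<open>1 \<in> d\<close> by auto
    with xy show "d \<in> (\<lambda>z. {1, z}) ` {3..<n}" by (intro image_eqI[of _ _ y]) auto
  next
    fix d assume "d \<in> (\<lambda>z. {1, z}) ` {3..<n}"
    then obtain z where "d = {1, z}" "3 \<le> z" "z < n" by auto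
    then show "d \<in> fan n 1" by (simp add: fan_def diagonals_iff)
  qed
  moreover have "inj_on (\<lambda>z. {1, z}) {3..<n}" by (auto simp: inj_on_def doubleton_eq_iff)
  ultimately show ?thesis by (simp add: card_image)
qed

text \<open>Flips preserve the cardinality and lead to the fan at \<open>1\<close>, which is counted
  directly.\<close>

lemma card_triangulation:
  assumes "triangulation n T" "3 \<le> n"
  shows "card T = n - 3"
  using assms(1)
proof (induction "defect 1 T" arbitrary: T)
  case 0
  then show ?case using defect_eq_0D[of n T 1] card_fan_1 assms(2) by simp
next
  case (Suc k)
  obtain d where "d \<in> T" "defect 1 (flip n T d) = k"
    using ex_flip_towards_vertex[OF Suc.prems, of 1 k] Suc.hyps(2) assms(2)
    by (metis One_nat_def Suc_leD le_refl numeral_3_eq_3)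
  then show ?case using Suc.hyps(1) triangulation_flip card_flip Suc.prems by metis
qed

text \<open>Some side \<open>{u, v}\<close> of the quadrilateral around any \<open>d\<close> is
  itself a diagonal of \<open>T\<close>. The corner \<open>u\<close> shared with \<open>d\<close> is
  the required vertex.\<close>

lemma ex_vertex_defect:
  assumes T: "triangulation n T" and n: "5 \<le> n"
  obtains v where "1 \<le> v" "v \<le> n" "defect v T \<le> n - 5"
proof -
  have c: "card T = n - 3" using card_triangulation[OF T] n by simp
  then obtain d where d: "d \<in> T" using n by fastforce
  note f = flips_to_flipped_diagonal[OF T d]
  obtain u v where uv: "u \<in> d" "v \<in> flipped_diagonal n T d" "{u, v} \<notin> sides n"
    using crossing_ex_not_side[OF crossing_flipped_diagonal[OF T d] n] .
  then have uvT: "{u, v} \<in> T" "{u, v} \<noteq> d" using flips_to_edge[OF f uv(1,2)] by blast+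
  have "1 \<le> u" "u \<le> n" using edge_range[OF T, of u v] uvT n by auto
  moreover have "{f \<in> T. u \<notin> f} \<subseteq> T - {d, {u, v}}" using uv by blast
  then have "defect u T \<le> card (T - {d, {u, v}})"
    unfolding defect_def using triangulation_finite[OF T] by (intro card_mono) auto
  moreover have "card (T - {d, {u, v}}) = n - 5"
    using c d uvT by (simp add: card_Diff_subset)
  ultimately show thesis using that by metis
qed

section \<open>Pairs of disjoint triangulations\<close>

lemma flip_neq: "triangulation n T \<Longrightarrow> d \<in> T \<Longrightarrow> flip n T d \<noteq> T"
  by (metis flip_eq flipped_diagonal_notin insertI1)

text \<open>The diagonal \<open>d\<close> can be recovered as the only member of \<open>T\<close>
  missing after the flip.\<close>

lemma flip_inject:
  assumes T: "triangulation n T" and d: "d \<in> T" "d' \<in> T" and eq: "flip n T d = flip n T d'"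
  shows "d = d'"
proof -
  have "d \<noteq> flipped_diagonal n T d" using flipped_diagonal_notin[OF T d(1)] d(1) by metis
  then have "d \<notin> flip n T d'" using flip_eq[OF T d(1)] eq[symmetric] by simp
  then show ?thesis using d(1) flip_eq[OF T d(2)] by simp
qed

lemma disjoint_pairs_swap: "prod.swap P \<in> disjoint_pairs n \<longleftrightarrow> P \<in> disjoint_pairs n"
  by (auto simp: disjoint_pairs_def)

text \<open>The map \<open>3 - i\<close> exchanges the indices \<open>1\<close> and
  \<open>2\<close>, so facts about the first component transfer to the second.\<close>

lemma component_swap: "i \<in> {1, 2} \<Longrightarrow> component (prod.swap P) (3 - i) = component P i"
  by (auto simp: component_def)

lemma pair_flip_swap: "i \<in> {1, 2} \<Longrightarrow> pair_flip n (prod.swap P) (3 - i) d = prod.swap (pair_flip n P i d)"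
  by (auto simp: pair_flip_def)

lemma pair_flip_1:
  assumes P: "P \<in> disjoint_pairs n" and d: "d \<in> fst P"
  defines "Q \<equiv> pair_flip n P 1 d"
  shows "Q \<in> disjoint_pairs n" and "\<exists>i\<in>{1, 2}. \<exists>f\<in>component Q i. pair_flip n Q i f = P"
proof -
  obtain T1 T2 where P_eq: "P = (T1, T2)" by fastforce
  with P d have T: "triangulation n T1" "triangulation n T2" "T1 \<inter> T2 = {}" "d \<in> T1"
    by (auto simp: disjoint_pairs_def)
  define e where "e = flipped_diagonal n T1 d"
  note f1 = flip_properties[OF T(1,4), folded e_def]
  have Q: "Q = (flip n T1 d, if e \<in> T2 then flip n T2 e else T2)"
    by (simp add: Q_def P_eq pair_flip_def flip_if_present_def e_def)
  have "Q \<in> disjoint_pairs n \<and> (\<exists>i\<in>{1, 2}. \<exists>f\<in>component Q i. pair_flip n Q i f = P)"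
  proof (cases "e \<in> T2")
    case False
    have "Q \<in> disjoint_pairs n"
      using False f1(5,6) T Q by (auto simp: disjoint_pairs_def)
    \<comment> \<open>The reverse flip restores \<open>d\<close>, which lies in \<open>T1\<close>
      and so not in \<open>T2\<close>; no second flip is triggered.\<close>
    moreover have "pair_flip n Q 1 e = P" "e \<in> component Q 1"
      using False f1(5,7,8) T(3,4) Q P_eq by (auto simp: pair_flip_def flip_if_present_def component_def)
    ultimately show ?thesis by blast
  next
    case True
    define e' where "e' = flipped_diagonal n T2 e"
    note f2 = flip_properties[OF T(2) True, folded e'_def]
    have Q': "Q = (flip n T1 d, flip n T2 e)" using Q True by simp
    \<comment> \<open>The new first triangulation contains \<open>e\<close>, and \<open>e'\<close>
      crosses \<open>e\<close>.\<close>
    have e': "e' \<notin> flip n T1 d"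
      using triangulation_not_crossing(1)[OF f1(6), of e e'] f2(4) f1(5) by blast
    then have "flip n T1 d \<inter> flip n T2 e = {}" using T(3) unfolding f1(5) f2(5) by blast
    then have "Q \<in> disjoint_pairs n" using f1(6) f2(6) Q' by (simp add: disjoint_pairs_def)
    \<comment> \<open>Undoing starts in the other component: flipping \<open>e'\<close> restores
      \<open>e\<close>, which is present in the first one and is therefore flipped back to
      \<open>d\<close>.\<close>
    moreover have "pair_flip n Q 2 e' = P" "e' \<in> component Q 2"
      using f1(5,8) f2(5,7,8) Q' P_eq
      by (simp_all add: pair_flip_def flip_if_present_def component_def)
    ultimately show ?thesis by blast
  qed
  then show "Q \<in> disjoint_pairs n" and "\<exists>i\<in>{1, 2}. \<exists>f\<in>component Q i. pair_flip n Q i f = P"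
    by blast+
qed

lemma pair_flip_disjoint_pairs:
  assumes P: "P \<in> disjoint_pairs n" and d: "i \<in> {1, 2}" "d \<in> component P i"
  shows "pair_flip n P i d \<in> disjoint_pairs n"
proof (cases "i = 1")
  case True
  then show ?thesis using pair_flip_1(1)[OF P] d by (simp add: component_def)
next
  case False
  then have "i = 2" using d by simp
  then have "prod.swap (pair_flip n P i d) = pair_flip n (prod.swap P) 1 d"
    using pair_flip_swap[of 2 n P d] by simp
  moreover have "pair_flip n (prod.swap P) 1 d \<in> disjoint_pairs n"
    using P d \<open>i = 2\<close> by (intro pair_flip_1(1)) (simp_all add: disjoint_pairs_swap component_def)
  ultimately show ?thesis by (metis disjoint_pairs_swap)
qed

lemma pair_flip_reversible:
  assumes P: "P \<in> disjoint_pairs n" and d: "i \<in> {1, 2}" "d \<in> component P i"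
  shows "\<exists>j\<in>{1, 2}. \<exists>f\<in>component (pair_flip n P i d) j. pair_flip n (pair_flip n P i d) j f = P"
proof (cases "i = 1")
  case True
  then show ?thesis using pair_flip_1(2)[OF P] d by (simp add: component_def)
next
  case False
  then have "i = 2" using d by simp
  define Q where "Q = pair_flip n P i d"
  have Q: "prod.swap Q = pair_flip n (prod.swap P) 1 d"
    using pair_flip_swap[of 2 n P d] \<open>i = 2\<close> by (simp add: Q_def)
  have "\<exists>j\<in>{1, 2}. \<exists>f\<in>component (prod.swap Q) j. pair_flip n (prod.swap Q) j f = prod.swap P"
    using P d \<open>i = 2\<close> unfolding Q
    by (intro pair_flip_1(2)) (simp_all add: disjoint_pairs_swap component_def)
  then obtain j f where j: "j \<in> {1, 2}" "f \<in> component (prod.swap Q) j"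
    "pair_flip n (prod.swap Q) j f = prod.swap P" by blast
  have "f \<in> component Q (3 - j)" using component_swap[OF j(1), of "prod.swap Q"] j(2) by simp
  moreover have "pair_flip n Q (3 - j) f = P"
    using pair_flip_swap[OF j(1), of n "prod.swap Q" f] j(3) by simp
  moreover have "3 - j \<in> {1, 2}" using j(1) by auto
  ultimately show ?thesis unfolding Q_def by blast
qed

lemma pair_flip_neq:
  assumes P: "P \<in> disjoint_pairs n" and d: "i \<in> {1, 2}" "d \<in> component P i"
  shows "pair_flip n P i d \<noteq> P"
proof (cases "i = 1")
  case True
  then show ?thesis using P d flip_neq[of n "fst P" d]
    by (auto simp: pair_flip_def disjoint_pairs_def component_def)
next
  case False
  then show ?thesis using P d flip_neq[of n "snd P" d]
    by (auto simp: pair_flip_def disjoint_pairs_def component_def)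
qed

text \<open>Both quadrilaterals have diagonals \<open>d\<close> and \<open>e\<close>, hence the same
  sides; one that is not a polygon side would be a common diagonal.\<close>

lemma mutual_flip_impossible:
  assumes T: "triangulation n T1" "triangulation n T2" "T1 \<inter> T2 = {}" and n: "5 \<le> n"
    and d: "d \<in> T1" "flipped_diagonal n T1 d = e" and e: "e \<in> T2" "flipped_diagonal n T2 e = d"
  shows False
proof -
  have f: "flips_to n T1 d e" "flips_to n T2 e d" "crossing d e"
    using flip_properties(1,4)[OF T(1) d(1)] flip_properties(1)[OF T(2) e(1)] d(2) e(2) by auto
  obtain u v where uv: "u \<in> d" "v \<in> e" "{u, v} \<notin> sides n"
    using crossing_ex_not_side[OF f(3) n] .
  have "{u, v} \<in> T1" using flips_to_edge[OF f(1) uv(1,2)] uv(3) by blast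
  moreover have "{u, v} \<in> T2"
    using flips_to_edge[OF f(2) uv(2,1)] uv(3) by (simp add: insert_commute)
  ultimately show False using T(3) by blast
qed

lemma pair_flip_1_2_neq:
  assumes P: "P \<in> disjoint_pairs n" and n: "5 \<le> n" and d: "d \<in> fst P" and f: "f \<in> snd P"
  shows "pair_flip n P 1 d \<noteq> pair_flip n P 2 f"
proof
  assume eq: "pair_flip n P 1 d = pair_flip n P 2 f"
  have T: "triangulation n (fst P)" "triangulation n (snd P)" "fst P \<inter> snd P = {}"
    using P by (auto simp: disjoint_pairs_def)
  have 1: "flip n (fst P) d = flip_if_present n (fst P) (flipped_diagonal n (snd P) f)"
    and 2: "flip n (snd P) f = flip_if_present n (snd P) (flipped_diagonal n (fst P) d)"
    using eq by (simp_all add: pair_flip_def)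
  \<comment> \<open>A flip always changes its component, so the conditional flip on the right must
    have taken place, and by injectivity at \<open>d\<close>.\<close>
  have "flipped_diagonal n (snd P) f = d"
    using 1 flip_neq[OF T(1) d] flip_inject[OF T(1) d] by (metis flip_if_present_def)
  moreover have "flipped_diagonal n (fst P) d = f"
    using 2 flip_neq[OF T(2) f] flip_inject[OF T(2) f] by (metis flip_if_present_def)
  ultimately show False using mutual_flip_impossible[OF T n d _ f] by blast
qed

lemma pair_flip_inject:
  assumes P: "P \<in> disjoint_pairs n" and n: "5 \<le> n"
    and d: "i \<in> {1, 2}" "d \<in> component P i" and f: "j \<in> {1, 2}" "f \<in> component P j"
    and eq: "pair_flip n P i d = pair_flip n P j f"
  shows "i = j \<and> d = f"
proof -
  have T: "triangulation n (fst P)" "triangulation n (snd P)"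
    using P by (auto simp: disjoint_pairs_def)
  consider "i = 1" "j = 1" | "i = 2" "j = 2" | "i = 1" "j = 2" | "i = 2" "j = 1"
    using d(1) f(1) by blast
  then show ?thesis
  proof cases
    case 1
    then show ?thesis using eq d f flip_inject[OF T(1), of d f]
      by (simp add: pair_flip_def component_def)
  next
    case 2
    then show ?thesis using eq d f flip_inject[OF T(2), of d f]
      by (simp add: pair_flip_def component_def)
  next
    case 3
    then show ?thesis using eq d f pair_flip_1_2_neq[OF P n, of d f] by (simp add: component_def)
  next
    case 4
    then show ?thesis using eq d f pair_flip_1_2_neq[OF P n, of f d] by (simp add: component_def)
  qed
qed

section \<open>The flip graph\<close>

lemma flip_graph_simps [simp]:
  "verts (flip_graph n) = disjoint_pairs n"
  "(P, i, d) \<in> arcs (flip_graph n) \<longleftrightarrow> P \<in> disjoint_pairs n \<and> i \<in> {1, 2} \<and> d \<in> component P i"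
  "tail (flip_graph n) (P, i, d) = P"
  "head (flip_graph n) (P, i, d) = pair_flip n P i d"
  by (simp_all add: flip_graph_def)

lemma finite_disjoint_pairs: "finite (disjoint_pairs n)"
proof (rule finite_subset)
  show "disjoint_pairs n \<subseteq> Pow (diagonals n) \<times> Pow (diagonals n)"
    using triangulation_subset by (auto simp: disjoint_pairs_def)
  show "finite (Pow (diagonals n) \<times> Pow (diagonals n))" using finite_diagonals by simp
qed

lemma wf_digraph_flip_graph: "wf_digraph (flip_graph n)"
proof
  fix a assume a: "a \<in> arcs (flip_graph n)"
  obtain P i d where "a = (P, i, d)" using prod_cases3 by blast
  with a show "tail (flip_graph n) a \<in> verts (flip_graph n)" "head (flip_graph n) a \<in> verts (flip_graph n)"
    using pair_flip_disjoint_pairs[of P n i d] by simp_all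
qed

lemma finite_arcs_flip_graph: "finite (arcs (flip_graph n))"
proof (rule finite_subset)
  show "arcs (flip_graph n) \<subseteq> disjoint_pairs n \<times> {1, 2} \<times> diagonals n"
    using triangulation_subset[THEN subsetD] by (auto simp: disjoint_pairs_def component_def)
  show "finite (disjoint_pairs n \<times> {1, 2 :: nat} \<times> diagonals n)"
    using finite_disjoint_pairs finite_diagonals by simp
qed

lemma graph_flip_graph:
  assumes n: "5 \<le> n"
  shows "graph (flip_graph n)"
proof -
  interpret wf_digraph "flip_graph n" by (rule wf_digraph_flip_graph)
  have "symmetric (flip_graph n)"
    unfolding symmetric_conv
  proof
    fix a assume a: "a \<in> arcs (flip_graph n)"
    obtain P i d where eq: "a = (P, i, d)" using prod_cases3 by blast
    then have P: "P \<in> disjoint_pairs n" "i \<in> {1, 2}" "d \<in> component P i" using a by simp_all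
    obtain j f where "j \<in> {1, 2}" "f \<in> component (pair_flip n P i d) j"
        "pair_flip n (pair_flip n P i d) j f = P"
      using pair_flip_reversible[OF P] by blast
    then have "(pair_flip n P i d, j, f) \<in> arcs (flip_graph n)"
      "tail (flip_graph n) a = head (flip_graph n) (pair_flip n P i d, j, f)"
      "head (flip_graph n) a = tail (flip_graph n) (pair_flip n P i d, j, f)"
      using pair_flip_disjoint_pairs[OF P] eq by simp_all
    then show "\<exists>b\<in>arcs (flip_graph n). tail (flip_graph n) a = head (flip_graph n) b \<and>
        head (flip_graph n) a = tail (flip_graph n) b" by blast
  qed
  moreover have "tail (flip_graph n) a \<noteq> head (flip_graph n) a" if a: "a \<in> arcs (flip_graph n)" for a
  proof -
    obtain P i d where eq: "a = (P, i, d)" using prod_cases3 by blast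
    then show ?thesis using a pair_flip_neq[of P n i d] by simp
  qed
  moreover have "a = b" if ab: "a \<in> arcs (flip_graph n)" "b \<in> arcs (flip_graph n)"
    "arc_to_ends (flip_graph n) a = arc_to_ends (flip_graph n) b" for a b
  proof -
    obtain P i d where a: "a = (P, i, d)" using prod_cases3 by blast
    obtain Q j f where b: "b = (Q, j, f)" using prod_cases3 by blast
    have "Q = P" "pair_flip n P i d = pair_flip n P j f"
      using ab(3) by (auto simp: a b arc_to_ends_def)
    then show ?thesis using pair_flip_inject[of P n i d j f] n ab(1,2) unfolding a b by simp
  qed
  ultimately show ?thesis
    using finite_disjoint_pairs finite_arcs_flip_graph by unfold_locales simp_all
qed

lemma regular_flip_graph:
  assumes n: "3 \<le> n"
  shows "regular (2 * (n - 3)) (flip_graph n)"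
  unfolding regular_def
proof
  fix P assume "P \<in> verts (flip_graph n)"
  then have P: "P \<in> disjoint_pairs n" by simp
  then have T: "triangulation n (fst P)" "triangulation n (snd P)"
    by (auto simp: disjoint_pairs_def)
  have "out_arcs (flip_graph n) P = (\<lambda>d. (P, 1, d)) ` fst P \<union> (\<lambda>d. (P, 2, d)) ` snd P"
    using P by (auto simp: out_arcs_def component_def split: if_splits)
  moreover have "card ((\<lambda>d. (P, 1 :: nat, d)) ` fst P \<union> (\<lambda>d. (P, 2, d)) ` snd P) = card (fst P) + card (snd P)"
    using T[THEN triangulation_finite]
    by (subst card_Un_disjoint) (auto simp: card_image inj_on_def)
  ultimately show "out_degree (flip_graph n) P = 2 * (n - 3)"
    using card_triangulation[OF T(1) n] card_triangulation[OF T(2) n] by (simp add: out_degree_def)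
qed

section \<open>Paths to a pair of fans\<close>

lemma pair_flip_arc:
  "P \<in> disjoint_pairs n \<Longrightarrow> i \<in> {1, 2} \<Longrightarrow> d \<in> component P i \<Longrightarrow>
    (P, pair_flip n P i d) \<in> arcs_ends (flip_graph n)"
  unfolding arcs_ends_conv by (rule image_eqI[of _ _ "(P, i, d)"]) simp_all

text \<open>Forced flips may alter the second component along the way, hence the unspecified
  \<open>X\<close>.\<close>

lemma path_to_fan_first:
  assumes "P \<in> disjoint_pairs n" "1 \<le> v" "v \<le> n"
  shows "\<exists>X. (fan n v, X) \<in> disjoint_pairs n \<and>
    (P, fan n v, X) \<in> arcs_ends (flip_graph n) ^^ defect v (fst P)"
  using assms(1)
proof (induction "defect v (fst P)" arbitrary: P)
  case 0
  then have "triangulation n (fst P)" by (auto simp: disjoint_pairs_def)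
  then have "fst P = fan n v" using defect_eq_0D assms(2,3) 0(1) by simp
  then have "P = (fan n v, snd P)" by (metis prod.collapse)
  then show ?case using 0 by (metis relpow_0_I)
next
  case (Suc k)
  have T: "triangulation n (fst P)" using Suc.prems by (auto simp: disjoint_pairs_def)
  obtain d where d: "d \<in> fst P" "defect v (flip n (fst P) d) = k"
    using ex_flip_towards_vertex[OF T assms(2,3) Suc.hyps(2)[symmetric]] by blast
  define Q where "Q = pair_flip n P 1 d"
  have "k = defect v (fst Q)" using d(2) by (simp add: Q_def pair_flip_def)
  moreover have c: "d \<in> component P 1" using d(1) by (simp add: component_def)
  have "Q \<in> disjoint_pairs n" unfolding Q_def
    using pair_flip_disjoint_pairs[OF Suc.prems _ c] by simp
  ultimately obtain X where X: "(fan n v, X) \<in> disjoint_pairs n"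
    "(Q, fan n v, X) \<in> arcs_ends (flip_graph n) ^^ k"
    using Suc.hyps(1) by blast
  have "(P, Q) \<in> arcs_ends (flip_graph n)"
    unfolding Q_def using pair_flip_arc[OF Suc.prems _ c] by simp
  then show ?case using X relpow_Suc_I2 Suc.hyps(2) by metis
qed

lemma path_to_fan_second:
  assumes "(fan n v, X) \<in> disjoint_pairs n" "1 \<le> w" "w \<le> n" "{v, w} \<in> sides n" "v \<noteq> w"
  shows "((fan n v, X), fan n v, fan n w) \<in> arcs_ends (flip_graph n) ^^ defect w X"
  using assms(1)
proof (induction "defect w X" arbitrary: X)
  case 0
  then have "triangulation n X" by (auto simp: disjoint_pairs_def)
  then have "X = fan n w" using defect_eq_0D assms(2,3) 0(1) by simp
  then show ?case using 0(1) by (metis relpow_0_I)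
next
  case (Suc k)
  have T: "triangulation n X" using Suc.prems by (auto simp: disjoint_pairs_def)
  obtain d where d: "d \<in> X" "w \<in> flipped_diagonal n X d" "defect w (flip n X d) = k"
    using ex_flip_towards_vertex[OF T assms(2,3) Suc.hyps(2)[symmetric]] by blast
  define e where "e = flipped_diagonal n X d"
  have e: "e \<in> diagonals n" "w \<in> e"
    using flipped_diagonal_in_diagonals[OF T d(1)] d(2) by (simp_all add: e_def)
  \<comment> \<open>A new diagonal through both \<open>v\<close> and \<open>w\<close> would be the
    side \<open>{v, w}\<close>. So \<open>e\<close> is not in the fan at \<open>v\<close>, and no
    flip is forced there.\<close>
  have "v \<notin> e"
  proof
    assume "v \<in> e"
    obtain a b where "e = {a, b}" using e(1) by (rule diagonalE)
    then have "e = {v, w}" using \<open>v \<in> e\<close> e(2) assms(5) by auto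
    then show False using e(1) assms(4) by (simp add: diagonals_def)
  qed
  then have "pair_flip n (fan n v, X) 2 d = (fan n v, flip n X d)"
    by (simp add: pair_flip_def flip_if_present_def fan_def e_def)
  moreover have c: "d \<in> component (fan n v, X) 2" using d(1) by (simp add: component_def)
  ultimately have Q: "(fan n v, flip n X d) \<in> disjoint_pairs n"
    "((fan n v, X), fan n v, flip n X d) \<in> arcs_ends (flip_graph n)"
    using pair_flip_disjoint_pairs[OF Suc.prems _ c] pair_flip_arc[OF Suc.prems _ c] by simp_all
  have "((fan n v, flip n X d), fan n v, fan n w) \<in> arcs_ends (flip_graph n) ^^ k"
    using Suc.hyps(1)[of "flip n X d"] d(3) Q(1) by simp
  then show ?case using Q(2) relpow_Suc_I2 Suc.hyps(2) by metis
qed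

text \<open>The triangle of \<open>X\<close> on the side \<open>{v, w}\<close> has a diagonal at \<open>w\<close>, since none is left at \<open>v\<close>.\<close>

lemma defect_second_le:
  assumes X: "(fan n v, X) \<in> disjoint_pairs n" and n: "4 \<le> n"
    and a: "{v, w} = {a, a + 1}" "1 \<le> a" "a < n"
  shows "defect w X \<le> n - 4"
proof -
  have T: "triangulation n X" "fan n v \<inter> X = {}" using X by (auto simp: disjoint_pairs_def)
  obtain c where c: "c < a \<or> a + 1 < c" "{a, c} \<in> sides n \<union> X" "{c, a + 1} \<in> sides n \<union> X"
    using outer_apex[OF T(1), of a "a + 1"] side_Suc[of a n] a(2,3) n by auto
  have nv: "f \<notin> X" if "v \<in> f" for f
    using that T triangulation_subset[OF T(1)] by (auto simp: fan_def)
  \<comment> \<open>A triangle consisting of polygon sides only would be the whole polygon, against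
    \<open>4 \<le> n\<close>.\<close>
  have "\<not> ({a, c} \<in> sides n \<and> {c, a + 1} \<in> sides n)"
  proof (cases "c < a")
    case True
    then have "{a, c} = {c, a}" by blast
    then show ?thesis using True a n sides_iff[of c a n] sides_iff[of c "a + 1" n] by auto
  next
    case False
    then have "{c, a + 1} = {a + 1, c}" "a + 1 < c" using c(1) by auto
    then show ?thesis using a n sides_iff[of a c n] sides_iff[of "a + 1" c n] by auto
  qed
  moreover have "v = a \<and> w = a + 1 \<or> v = a + 1 \<and> w = a" using a(1) by (auto simp: doubleton_eq_iff)
  ultimately obtain f where f: "f \<in> X" "w \<in> f" using c(2,3) nv by blast
  have "{f \<in> X. w \<notin> f} \<subseteq> X - {f}" using f by blast
  then have "defect w X \<le> card (X - {f})"
    unfolding defect_def using triangulation_finite[OF T(1)] by (intro card_mono) auto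
  also have "\<dots> = n - 4" using card_triangulation[OF T(1)] f(1) n by simp
  finally show ?thesis .
qed

lemma defect_le: "triangulation n T \<Longrightarrow> 3 \<le> n \<Longrightarrow> defect v T \<le> n - 3"
  using card_mono[of T "{d \<in> T. v \<notin> d}"] triangulation_finite[of n T] card_triangulation[of n T]
  by (auto simp: defect_def)

lemma relpow_sym:
  assumes "sym R" "(x, y) \<in> R ^^ k"
  shows "(y, x) \<in> R ^^ k"
  using assms(2)
proof (induction k arbitrary: y)
  case (Suc k)
  then obtain z where "(x, z) \<in> R ^^ k" "(z, y) \<in> R" by (meson relpow_Suc_E)
  then show ?case using Suc.IH assms(1) relpow_Suc_I2 by (metis symD)
qed simp

lemma short_path:
  assumes n: "5 \<le> n" and P: "P \<in> disjoint_pairs n" and Q: "Q \<in> disjoint_pairs n"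
  shows "\<exists>k\<le>4 * n - 16. (P, Q) \<in> arcs_ends (flip_graph n) ^^ k"
proof -
  let ?R = "arcs_ends (flip_graph n)"
  have "sym ?R" using graph_flip_graph[OF n] unfolding graph_def pseudo_graph_def sym_digraph_def
      sym_digraph_axioms_def symmetric_def by blast
  have TP: "triangulation n (fst P)" and TQ: "triangulation n (fst Q)"
    using P Q by (auto simp: disjoint_pairs_def)
  obtain v where v: "1 \<le> v" "v \<le> n" "defect v (fst P) \<le> n - 5"
    using ex_vertex_defect[OF TP n] by blast
  \<comment> \<open>The neighbour \<open>w\<close> is \<open>v + 1\<close>, or \<open>n - 1\<close>
    if \<open>v = n\<close>; \<open>a\<close> is the smaller endpoint, so the side always has the
    form \<open>{a, a + 1}\<close>.\<close>
  define a where "a = (if v < n then v else n - 1)"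
  define w where "w = (if v < n then v + 1 else n - 1)"
  have a: "{v, w} = {a, a + 1}" "1 \<le> a" "a < n" using v n by (auto simp: a_def w_def)
  then have side: "{v, w} \<in> sides n" using side_Suc[of a n] by simp
  have w: "1 \<le> w" "w \<le> n" "v \<noteq> w" using v n by (auto simp: w_def)
  let ?k = "\<lambda>P X. defect v (fst P) + defect w X"
  have to_fans: "\<exists>X. (fan n v, X) \<in> disjoint_pairs n \<and> (P, fan n v, fan n w) \<in> ?R ^^ ?k P X"
    if "P \<in> disjoint_pairs n" for P
    using path_to_fan_first[OF that v(1,2)] path_to_fan_second[OF _ w(1,2) side w(3)]
    by (meson relpow_trans)
  obtain X where X: "(fan n v, X) \<in> disjoint_pairs n" "(P, fan n v, fan n w) \<in> ?R ^^ ?k P X"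
    using to_fans[OF P] by blast
  obtain Y where Y: "(fan n v, Y) \<in> disjoint_pairs n" "(Q, fan n v, fan n w) \<in> ?R ^^ ?k Q Y"
    using to_fans[OF Q] by blast
  \<comment> \<open>The path from \<open>Q\<close> to the same pair of fans is traversed backwards
    by symmetry.\<close>
  have "(P, Q) \<in> ?R ^^ (?k P X + ?k Q Y)"
    using relpow_trans[OF X(2) relpow_sym[OF \<open>sym ?R\<close> Y(2)]] .
  moreover have "defect w X \<le> n - 4" "defect w Y \<le> n - 4" "defect v (fst Q) \<le> n - 3"
    using defect_second_le[OF X(1) _ a] defect_second_le[OF Y(1) _ a] defect_le[OF TQ] n by auto
  then have "?k P X + ?k Q Y \<le> 4 * n - 16" using v(3) n by linarith
  ultimately show ?thesis by blast
qed

section \<open>From paths to distances and connectedness\<close>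

lemma (in wf_digraph) relpow_awalk:
  assumes "(u, v) \<in> arcs_ends G ^^ k" "u \<in> verts G"
  shows "\<exists>p. awalk u p v \<and> length p = k"
  using assms
proof (induction k arbitrary: u)
  case 0
  then show ?case by (auto simp: awalk_Nil_iff)
next
  case (Suc k)
  obtain z where z: "(u, z) \<in> arcs_ends G" "(z, v) \<in> arcs_ends G ^^ k"
    using relpow_Suc_D2[OF Suc.prems(1)] by blast
  then obtain a where a: "a \<in> arcs G" "tail G a = u" "head G a = z" by auto
  then have "z \<in> verts G" by auto
  then obtain p where "awalk z p v" "length p = k" using Suc.IH z(2) by blast
  then show ?case using a by (intro exI[of _ "a # p"]) (auto simp: awalk_Cons_iff)
qed

text \<open>With unit weights the cost of a walk is its number of arcs, and any walk bounds the
  infimum.\<close>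

lemma (in wf_digraph) unit_distance_le:
  assumes "(u, v) \<in> arcs_ends G ^^ k" "u \<in> verts G"
  shows "\<mu> (\<lambda>_. 1) u v \<le> ereal k"
proof -
  obtain p where p: "awalk u p v" "length p = k" using relpow_awalk[OF assms] by blast
  have "awalk_cost (\<lambda>_. 1) p = k" using p(2) by (simp add: awalk_cost_def sum_list_triv)
  then show ?thesis using min_cost_le_walk_cost[OF p(1), of "\<lambda>_. 1"] by simp
qed

text \<open>Connectedness includes having a vertex. The fans at \<open>1\<close> and
  \<open>2\<close> are disjoint because \<open>{1, 2}\<close> is a side.\<close>

lemma disjoint_pairs_nonempty:
  assumes "2 \<le> n"
  shows "disjoint_pairs n \<noteq> {}"
proof -
  have "fan n 1 \<inter> fan n 2 = {}"
  proof -
    have False if "d \<in> diagonals n" "1 \<in> d" "2 \<in> d" for d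
      using that(1) by (rule diagonalE) (use that in auto)
    then show ?thesis unfolding fan_def by blast
  qed
  then have "(fan n 1, fan n 2) \<in> disjoint_pairs n"
    using triangulation_fan assms by (simp add: disjoint_pairs_def)
  then show ?thesis by blast
qed

lemma connected_flip_graph:
  assumes n: "5 \<le> n"
  shows "connected (flip_graph n)"
proof -
  interpret graph "flip_graph n" by (rule graph_flip_graph[OF n])
  have "(P, Q) \<in> (arcs_ends (flip_graph n))\<^sup>*" if "P \<in> disjoint_pairs n" "Q \<in> disjoint_pairs n" for P Q
    using short_path[OF n that] relpow_imp_rtrancl by blast
  then have "P \<rightarrow>\<^sup>*\<^bsub>mk_symmetric (flip_graph n)\<^esub> Q"
    if "P \<in> disjoint_pairs n" "Q \<in> disjoint_pairs n" for P Q
    using that by (intro reachable_mk_symmetricI) (simp add: reachable_conv)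
  then show ?thesis
    using disjoint_pairs_nonempty[of n] n by (simp add: connected_def strongly_connected_def)
qed

theorem theorem1p3:
  fixes n :: nat
  assumes "n \<ge> 5"
  shows "graph (flip_graph n) \<and> connected (flip_graph n) \<and>
    regular (2 * (n - 3)) (flip_graph n) \<and>
    graph_diameter (flip_graph n) \<le> ereal (4 * real n - 16)"
proof (intro conjI)
  show "graph (flip_graph n)" using graph_flip_graph[OF assms] .
  show "connected (flip_graph n)" using connected_flip_graph[OF assms] .
  show "regular (2 * (n - 3)) (flip_graph n)" using assms by (intro regular_flip_graph) simp
  interpret wf_digraph "flip_graph n" by (rule wf_digraph_flip_graph)
  have "\<mu> (\<lambda>_. 1) P Q \<le> ereal (4 * real n - 16)"
    if PQ: "P \<in> disjoint_pairs n" "Q \<in> disjoint_pairs n" for P Q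
  proof -
    obtain k where k: "k \<le> 4 * n - 16" "(P, Q) \<in> arcs_ends (flip_graph n) ^^ k"
      using short_path[OF assms PQ] by blast
    have "\<mu> (\<lambda>_. 1) P Q \<le> ereal k" using unit_distance_le[OF k(2)] PQ by simp
    \<comment> \<open>As \<open>5 \<le> n\<close>, the truncated difference agrees with the real
      one.\<close>
    also have "ereal k \<le> ereal (4 * real n - 16)" using k(1) assms by simp
    finally show ?thesis .
  qed
  then show "graph_diameter (flip_graph n) \<le> ereal (4 * real n - 16)"
    unfolding graph_diameter_def by (auto intro!: SUP_least)
qed

end
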